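(* Let $(Q,\cdot,\backslash,/)$ be a middle Bol loop with identity $e$, and let $f_1,g_1,f_2,g_2:Q^2\to Q$, where $f_1(x,y)=(yx)\backslash x$ and $g_1(x,y)=(xy)\backslash x$. 1. $f_2(x,y)=x/(xy)$ for all $x,y$ if and only if $f_2(x,y)=(x/y)/x$ for all $x,y$. For this $f_2$ and all $x$: (a) $f_2(x,x)=f_2(e,x)=f_2(x^{-1},x)=x^{-1}$; (b) $f_2(x,x^{-1})=f_2(e,x^{-1})=x$; (c) $f_2(x,e)=f_2(x^{-1},e)=f_2(e,e)=e$. 2. $g_2(x,y)=x/(yx)$ for all $x,y$ if and only if $g_2(x,y)=(y\backslash x)/x$ for all $x,y$. For this $g_2$ and all $x$: (a) $g_2(x,x)=g_2(e,x)=g_2(x^{-1},x)=x^{-1}$; (b) $g_2(x,x^{-1})=g_2(e,x^{-1})=x$; (c) $g_2(x,e)=g_2(x^{-1},e)=g_2(e,e)=e$. With $f_2,g_2$ these maps (in items 3–7 each identity is required for all $x,y\in Q$): 3. The following are equivalent: (a) $f_2(x,y)=g_2(x,y)$; (b) $(Q,\cdot)$ is commutative; (c) $(Q,(\backslash)^* )\equiv(Q,/)$; (d) $(Q,\backslash)\equiv(Q,(/)^* )$; (e) $x/(xy)=(y\backslash x)/x$; (f) $x/(yx)=(x/y)/x$. 4. The following are equivalent: (a) $f_1(x,y)=f_2(x,y)$; (b) $((yx)\backslash x)(xy)=x$; (c) $(yx)(x/(xy))=x$; (d) $x\backslash(y\backslash x)=(x/y)/x$. 5. The following are equivalent: (a)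 $g_1(x,y)=g_2(x,y)$; (b) $((xy)\backslash x)(yx)=x$; (c) $(xy)(x/(yx))=x$; (d) $x\backslash(x/y)=(y\backslash x)/x$. 6. The following are equivalent: (a) $f_1(x,y)=g_2(x,y)$; (b) $(yx)(x/(yx))=x$; (c) $((yx)\backslash x)(yx)=x$; (d) $x[(y\backslash x)/x]=y\backslash x$; (e) $[x\backslash(y\backslash x)]x=y\backslash x$. 7. The following are equivalent: (a) $f_2(x,y)=g_1(x,y)$; (b) $((xy)\backslash x)(xy)=x$; (c) $((yx)\backslash x)(yx)=x$; (d) $x[(x/y)/x]=x/y$; (e) $[x\backslash(x/y)]x=x/y$. Moreover, for all $x,y,z\in Q$: 8. $f_2(x,y)f_1(x,z)=x\big[((zx)(xy))\backslash x\big]=\big[x/((zx)(xy))\big]x$. 9. $[(x/y)/x][x\backslash(z\backslash x)]=x\big[((zx)(xy))\backslash x\big]=\big[x/((zx)(xy))\big]x$. 10. $g_2(x,y)g_1(x,z)=x\big[((xz)(yx))\backslash x\big]=\big[x/((xz)(yx))\big]x$. 11. $[(y\backslash x)/x][x\backslash(x/z)]=x\big[((xz)(yx))\backslash x\big]=\big[x/((xz)(yx))\big]x$. 12. $f_2(x,y)g_1(x,z)=x\big[((xz)(xy))\backslash x\big]=\big[x/((xz)(xy))\big]x$. 13. $[(x/y)/x][x\backslash(x/z)]=x\big[((xz)(xy))\backslash x\big]=\big[x/((xz)(xy))\big]x$. 14. $g_2(x,y)f_1(x,z)=x\big[((zx)(yx))\backslash x\big]=\big[x/((zx)(yx))\big]x$.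 15. $[(y\backslash x)/x][x\backslash(z\backslash x)]=x\big[((zx)(yx))\backslash x\big]=\big[x/((zx)(yx))\big]x$.
   Context: A loop $(Q,\cdot,\backslash,/)$ is a loop $(Q,\cdot)$ with identity $e$, where $x\backslash y$ is the unique $z$ with $x\cdot z=y$ and $x/y$ is the unique $z$ with $z\cdot y=x$. It is a middle Bol loop if $x((yz)\backslash x)=(x/z)(y\backslash x)$ for all $x,y,z$. In a middle Bol loop left and right inverses coincide; $x^{-1}$ denotes the two-sided inverse. In a middle Bol loop $f_1(x,y)=(yx)\backslash x$ may equally be written $x\backslash(y\backslash x)$, and $g_1(x,y)=(xy)\backslash x$ may equally be written $x\backslash(x/y)$. For a binary operation, the superscript $*$ denotes the opposite operation: $x(\backslash)^*y=y\backslash x$, $x(/)^*y=y/x$; $\equiv$ between groupoids on $Q$ means the operations coincide. *)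

theory Defs
  imports "HOL-Algebra.Group"
begin

text \<open>
  Loops are represented by the records of \<^theory>\<open>HOL-Algebra.Group\<close>: a carrier, a
  multiplication and an identity. Divisions are determined by the multiplication, so they are
  defined by unique description instead of being further record fields.
\<close>

definition ldiv :: "('a, 'b) monoid_scheme \<Rightarrow> 'a \<Rightarrow> 'a \<Rightarrow> 'a" (infixl "\<setminus>\<index>" 70)
  where "ldiv Q x y = (THE z. z \<in> carrier Q \<and> x \<otimes>\<^bsub>Q\<^esub> z = y)"

definition rdiv :: "('a, 'b) monoid_scheme \<Rightarrow> 'a \<Rightarrow> 'a \<Rightarrow> 'a" (infixl "\<oslash>\<index>" 70)
  where "rdiv Q x y = (THE z. z \<in> carrier Q \<and> z \<otimes>\<^bsub>Q\<^esub> y = x)"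

locale loop =
  fixes Q (structure)
  assumes m_closed: "\<lbrakk>x \<in> carrier Q; y \<in> carrier Q\<rbrakk> \<Longrightarrow> x \<otimes> y \<in> carrier Q"
    and one_closed: "\<one> \<in> carrier Q"
    and l_one: "x \<in> carrier Q \<Longrightarrow> \<one> \<otimes> x = x"
    and r_one: "x \<in> carrier Q \<Longrightarrow> x \<otimes> \<one> = x"
    and ldiv_ex1: "\<lbrakk>x \<in> carrier Q; y \<in> carrier Q\<rbrakk> \<Longrightarrow> \<exists>!z. z \<in> carrier Q \<and> x \<otimes> z = y"
    and rdiv_ex1: "\<lbrakk>x \<in> carrier Q; y \<in> carrier Q\<rbrakk> \<Longrightarrow> \<exists>!z. z \<in> carrier Q \<and> z \<otimes> y = x"

locale middle_bol_loop = loop +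
  assumes middle_bol: "\<lbrakk>x \<in> carrier Q; y \<in> carrier Q; z \<in> carrier Q\<rbrakk>
    \<Longrightarrow> x \<otimes> ((y \<otimes> z) \<setminus> x) = (x \<oslash> z) \<otimes> (y \<setminus> x)"

definition opposite :: "('a \<Rightarrow> 'a \<Rightarrow> 'a) \<Rightarrow> 'a \<Rightarrow> 'a \<Rightarrow> 'a"
  where "opposite op x y = op y x"

definition groupoid_equiv :: "'a set \<Rightarrow> ('a \<Rightarrow> 'a \<Rightarrow> 'a) \<Rightarrow> ('a \<Rightarrow> 'a \<Rightarrow> 'a) \<Rightarrow> bool"
  where "groupoid_equiv A op1 op2 \<longleftrightarrow> (\<forall>x\<in>A. \<forall>y\<in>A. op1 x y = op2 x y)"

definition all_equivalent :: "bool list \<Rightarrow> bool"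
  where "all_equivalent Ps \<longleftrightarrow> (\<forall>P\<in>set Ps. \<forall>R\<in>set Ps. P \<longleftrightarrow> R)"

lemma (in loop) ldiv_closed: 
  assumes "x \<in> carrier Q" "y \<in> carrier Q"
  shows "x \<setminus> y \<in> carrier Q" and "x \<otimes> (x \<setminus> y) = y"
  using theI'[OF ldiv_ex1[OF assms]] unfolding ldiv_def by auto

lemma (in loop) rdiv_closed:
  assumes "x \<in> carrier Q" "y \<in> carrier Q"
  shows "x \<oslash> y \<in> carrier Q" and "(x \<oslash> y) \<otimes> y = x"
  using theI'[OF rdiv_ex1[OF assms]] unfolding rdiv_def by auto

lemma (in loop) ldiv_unique:
  assumes "x \<in> carrier Q" "z \<in> carrier Q" "x \<otimes> z = y"
  shows "x \<setminus> y = z"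
  using assms ldiv_ex1[of x y] ldiv_closed[of x y] m_closed by blast

lemma (in loop) rdiv_unique:
  assumes "y \<in> carrier Q" "z \<in> carrier Q" "z \<otimes> y = x"
  shows "x \<oslash> y = z"
  using assms rdiv_ex1[of x y] rdiv_closed[of x y] m_closed by blast

text \<open>
  Left and right inverses coincide in a middle Bol loop, so the two-sided inverse \<^const>\<open>m_inv\<close>
  is well defined there.
\<close>

lemma (in middle_bol_loop) inv_eq:
  assumes x: "x \<in> carrier Q"
  shows "inv x = x \<setminus> \<one>" and "inv x = \<one> \<oslash> x"
proof -
  have "\<one> \<setminus> \<one> = \<one>" by (rule ldiv_unique) (simp_all add: one_closed l_one)
  then have eq: "x \<setminus> \<one> = \<one> \<oslash> x"
    using middle_bol[of \<one> \<one> x] x one_closed l_one r_one ldiv_closed(1) rdiv_closed(1) by simp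
  have "inv x = x \<setminus> \<one>"
    unfolding m_inv_def
  proof (rule the_equality)
    show "x \<setminus> \<one> \<in> carrier Q \<and> x \<otimes> (x \<setminus> \<one>) = \<one> \<and> (x \<setminus> \<one>) \<otimes> x = \<one>"
      using x one_closed ldiv_closed[of x \<one>] rdiv_closed[of \<one> x] eq by simp
  next
    fix y assume "y \<in> carrier Q \<and> x \<otimes> y = \<one> \<and> y \<otimes> x = \<one>"
    then show "y = x \<setminus> \<one>" using ldiv_unique[of x y \<one>] x by simp
  qed
  then show "inv x = x \<setminus> \<one>" and "inv x = \<one> \<oslash> x" using eq by simp_all
qed

end

theory Submission
  imports Defs
begin

text \<open>
  Everything rests on reading the middle Bol identity as a statement about a fixed \<open>x\<close>: the
  product of a right quotient \<open>x \<oslash> z\<close> and a left quotient \<open>y \<setminus> x\<close> of the same element depends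
  only on \<open>y \<otimes> z\<close>. Taking \<open>y = \<one>\<close> turns \<open>x \<otimes> (u \<setminus> x)\<close> into \<open>(x \<oslash> u) \<otimes> x\<close>
  (lemma \<open>mult_ldiv_eq_rdiv_mult\<close>), which lets left and right quotients be exchanged. Taking
  \<open>y = x\<close> or \<open>z = x\<close> makes one factor trivial and so computes \<open>x \<otimes> ((x \<otimes> y) \<setminus> x)\<close> and
  \<open>x \<otimes> ((y \<otimes> x) \<setminus> x)\<close>; cancelling \<open>x\<close> on the left gives the alternative forms of \<open>f\<^sub>1\<close> and
  \<open>g\<^sub>1\<close>, and cancelling it on the right, after the exchange, those of \<open>f\<^sub>2\<close> and \<open>g\<^sub>2\<close>. The product
  formulas are the middle Bol identity itself, with \<open>x \<otimes> y\<close> or \<open>y \<otimes> x\<close> and \<open>x \<otimes> z\<close> or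
  \<open>z \<otimes> x\<close> as the denominators.

  The equivalences follow from these alternative forms by reasoning valid in any loop. An equation between a
  left quotient and a right quotient can be cleared of either division
  (lemma \<open>ldiv_eq_rdiv_iff\<close>), so within a list most conditions are equivalent for each fixed
  \<open>x\<close> and \<open>y\<close>. There are two exceptions: commutativity is related to the two conditions on the
  division groupoids, and in the last list \<open>x \<otimes> y\<close> is exchanged for \<open>y \<otimes> x\<close>; there one uses that
  translations are surjective.
\<close>

section \<open>Quotients in loops\<close>

context loop
begin

lemma left_cancel_iff:
  assumes "x \<in> carrier Q" "y \<in> carrier Q" "z \<in> carrier Q"
  shows "x \<otimes> y = x \<otimes> z \<longleftrightarrow> y = z"
  using assms ldiv_unique by metis

lemma mult_rdiv_cancel:
  assumes "x \<in> carrier Q" "y \<in> carrier Q"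
  shows "(x \<otimes> y) \<oslash> y = x"
  using assms by (intro rdiv_unique) auto

lemma ldiv_self: "x \<in> carrier Q \<Longrightarrow> x \<setminus> x = \<one>"
  by (rule ldiv_unique) (simp_all add: one_closed r_one)

lemma rdiv_self: "x \<in> carrier Q \<Longrightarrow> x \<oslash> x = \<one>"
  by (rule rdiv_unique) (simp_all add: one_closed l_one)

lemma one_ldiv: "x \<in> carrier Q \<Longrightarrow> \<one> \<setminus> x = x"
  by (rule ldiv_unique) (simp_all add: one_closed l_one)

lemma rdiv_one: "x \<in> carrier Q \<Longrightarrow> x \<oslash> \<one> = x"
  by (rule rdiv_unique) (simp_all add: one_closed r_one)

lemma rdiv_left_cancel_iff:
  assumes "x \<in> carrier Q" "y \<in> carrier Q" "z \<in> carrier Q"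
  shows "x \<oslash> y = x \<oslash> z \<longleftrightarrow> y = z"
proof
  assume "x \<oslash> y = x \<oslash> z"
  then have "(x \<oslash> y) \<otimes> y = (x \<oslash> y) \<otimes> z"
    using rdiv_closed(2)[of x y] rdiv_closed(2)[of x z] assms by simp
  then show "y = z"
    using assms left_cancel_iff rdiv_closed(1) by blast
qed simp

text \<open>
  This clears divisions in all the lists of equivalent conditions. The numerators are independent
  because it is applied both to \<open>u \<setminus> x = x \<oslash> v\<close> and to \<open>x \<setminus> u = u \<oslash> x\<close>.
\<close>

lemma ldiv_eq_rdiv_iff:
  assumes "a \<in> carrier Q" "b \<in> carrier Q" "p \<in> carrier Q" "q \<in> carrier Q"
  shows "(a \<setminus> p) \<otimes> b = q \<longleftrightarrow> a \<setminus> p = q \<oslash> b"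
    and "a \<otimes> (q \<oslash> b) = p \<longleftrightarrow> a \<setminus> p = q \<oslash> b"
  using assms ldiv_closed rdiv_closed ldiv_unique rdiv_unique by metis+

text \<open>
  Every element \<open>x\<close> is a product \<open>(x \<oslash> y) \<otimes> y\<close> and also \<open>y \<otimes> (y \<setminus> x)\<close>. If the two quotients of
  \<open>x\<close> by \<open>y\<close> agree, then \<open>y\<close> commutes with that quotient, and every element is a quotient by \<open>y\<close>.
\<close>

lemma commutative_iff_ldiv_eq_rdiv:
  "(\<forall>x\<in>carrier Q. \<forall>y\<in>carrier Q. x \<otimes> y = y \<otimes> x) \<longleftrightarrow>
   (\<forall>x\<in>carrier Q. \<forall>y\<in>carrier Q. y \<setminus> x = x \<oslash> y)"
proof (intro iffI ballI)
  fix x y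
  assume comm: "\<forall>x\<in>carrier Q. \<forall>y\<in>carrier Q. x \<otimes> y = y \<otimes> x"
    and x: "x \<in> carrier Q" and y: "y \<in> carrier Q"
  have "y \<otimes> (x \<oslash> y) = (x \<oslash> y) \<otimes> y"
    using comm x y rdiv_closed(1) by blast
  then show "y \<setminus> x = x \<oslash> y"
    using x y by (intro ldiv_unique) (simp_all add: rdiv_closed)
next
  fix x y
  assume eq: "\<forall>x\<in>carrier Q. \<forall>y\<in>carrier Q. y \<setminus> x = x \<oslash> y"
    and x: "x \<in> carrier Q" and y: "y \<in> carrier Q"
  have "y \<setminus> (x \<otimes> y) = x"
    using eq x y by (simp add: m_closed mult_rdiv_cancel)
  then show "x \<otimes> y = y \<otimes> x"
    using ldiv_closed(2)[OF y m_closed[OF x y]] by simp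
qed

end

section \<open>Quotients in middle Bol loops\<close>

context middle_bol_loop
begin

lemma inv_closed: "x \<in> carrier Q \<Longrightarrow> inv x \<in> carrier Q"
  by (simp add: inv_eq(1) ldiv_closed one_closed)

lemma r_inv: "x \<in> carrier Q \<Longrightarrow> x \<otimes> inv x = \<one>"
  by (simp add: inv_eq(1) ldiv_closed one_closed)

lemma l_inv: "x \<in> carrier Q \<Longrightarrow> inv x \<otimes> x = \<one>"
  by (simp add: inv_eq(2) rdiv_closed one_closed)

lemma one_rdiv_inv: "x \<in> carrier Q \<Longrightarrow> \<one> \<oslash> inv x = x"
  by (rule rdiv_unique) (simp_all add: inv_closed r_inv)

lemma inv_inv: "x \<in> carrier Q \<Longrightarrow> inv (inv x) = x"
  by (simp add: inv_eq(2)[of "inv x"] inv_closed one_rdiv_inv)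

text \<open>The middle Bol identity with \<open>y = \<one>\<close>.\<close>

lemma mult_ldiv_eq_rdiv_mult:
  assumes "x \<in> carrier Q" "u \<in> carrier Q"
  shows "x \<otimes> (u \<setminus> x) = (x \<oslash> u) \<otimes> x"
  using middle_bol[of x \<one> u] assms by (simp add: one_closed l_one one_ldiv)

text \<open>
  The two following lemmas are the middle Bol identity with \<open>z = x\<close> and with \<open>y = x\<close>: the factor
  \<open>x \<oslash> x\<close>, respectively \<open>x \<setminus> x\<close>, is \<open>\<one>\<close>.
\<close>

lemma mult_ldiv_mult_right:
  assumes "x \<in> carrier Q" "y \<in> carrier Q"
  shows "x \<otimes> ((y \<otimes> x) \<setminus> x) = y \<setminus> x"
  using middle_bol[of x y x] assms by (simp add: rdiv_self l_one ldiv_closed)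

lemma mult_ldiv_mult_left:
  assumes "x \<in> carrier Q" "y \<in> carrier Q"
  shows "x \<otimes> ((x \<otimes> y) \<setminus> x) = x \<oslash> y"
  using middle_bol[of x x y] assms by (simp add: ldiv_self r_one rdiv_closed)

lemma ldiv_ldiv_eq:
  assumes "x \<in> carrier Q" "y \<in> carrier Q"
  shows "x \<setminus> (y \<setminus> x) = (y \<otimes> x) \<setminus> x"
  using assms by (intro ldiv_unique) (simp_all add: mult_ldiv_mult_right ldiv_closed m_closed)

lemma ldiv_rdiv_eq:
  assumes "x \<in> carrier Q" "y \<in> carrier Q"
  shows "x \<setminus> (x \<oslash> y) = (x \<otimes> y) \<setminus> x"
  using assms by (intro ldiv_unique) (simp_all add: mult_ldiv_mult_left ldiv_closed m_closed)

lemma rdiv_rdiv_eq: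
  assumes "x \<in> carrier Q" "y \<in> carrier Q"
  shows "(x \<oslash> y) \<oslash> x = x \<oslash> (x \<otimes> y)"
  using assms
  by (intro rdiv_unique)
     (simp_all add: mult_ldiv_mult_left rdiv_closed m_closed flip: mult_ldiv_eq_rdiv_mult)

lemma ldiv_rdiv_right_eq:
  assumes "x \<in> carrier Q" "y \<in> carrier Q"
  shows "(y \<setminus> x) \<oslash> x = x \<oslash> (y \<otimes> x)"
  using assms
  by (intro rdiv_unique)
     (simp_all add: mult_ldiv_mult_right rdiv_closed m_closed flip: mult_ldiv_eq_rdiv_mult)

text \<open>
  Each of the product formulas for \<open>f\<^sub>1\<close>, \<open>g\<^sub>1\<close>, \<open>f\<^sub>2\<close>, \<open>g\<^sub>2\<close> is an instance: these maps are
  quotients of \<open>x\<close> by \<open>u\<close> or \<open>v\<close>, where \<open>u\<close> and \<open>v\<close> are products with \<open>x\<close> as one factor.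
\<close>

lemma rdiv_mult_ldiv:
  assumes "x \<in> carrier Q" "u \<in> carrier Q" "v \<in> carrier Q"
  shows "(x \<oslash> v) \<otimes> (u \<setminus> x) = x \<otimes> ((u \<otimes> v) \<setminus> x)"
    and "x \<otimes> ((u \<otimes> v) \<setminus> x) = (x \<oslash> (u \<otimes> v)) \<otimes> x"
  using assms by (simp_all add: mult_ldiv_eq_rdiv_mult m_closed flip: middle_bol)

lemma rdiv_mult_left_values:
  assumes "x \<in> carrier Q"
  shows "x \<oslash> (x \<otimes> x) = inv x" "\<one> \<oslash> (\<one> \<otimes> x) = inv x" "inv x \<oslash> (inv x \<otimes> x) = inv x"
    "x \<oslash> (x \<otimes> inv x) = x" "\<one> \<oslash> (\<one> \<otimes> inv x) = x"
    "x \<oslash> (x \<otimes> \<one>) = \<one>" "inv x \<oslash> (inv x \<otimes> \<one>) = \<one>"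
proof -
  show "x \<oslash> (x \<otimes> x) = inv x"
    using assms by (simp add: rdiv_self inv_eq(2) flip: rdiv_rdiv_eq)
  show "\<one> \<oslash> (\<one> \<otimes> x) = inv x"
    using assms by (simp add: l_one inv_eq(2))
qed (simp_all add: assms inv_closed one_closed l_one r_one l_inv r_inv rdiv_one rdiv_self
      one_rdiv_inv)

lemma rdiv_mult_right_values:
  assumes "x \<in> carrier Q"
  shows "x \<oslash> (x \<otimes> x) = inv x" "\<one> \<oslash> (x \<otimes> \<one>) = inv x" "inv x \<oslash> (x \<otimes> inv x) = inv x"
    "x \<oslash> (inv x \<otimes> x) = x" "\<one> \<oslash> (inv x \<otimes> \<one>) = x"
    "x \<oslash> (\<one> \<otimes> x) = \<one>" "inv x \<oslash> (\<one> \<otimes> inv x) = \<one>"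
proof -
  show "\<one> \<oslash> (x \<otimes> \<one>) = inv x"
    using assms by (simp add: r_one inv_eq(2))
qed (simp_all add: assms rdiv_mult_left_values(1) inv_closed one_closed l_one r_one l_inv r_inv
      rdiv_one rdiv_self one_rdiv_inv)

section \<open>Equivalent conditions\<close>

text \<open>
  With the first condition as pivot, a list needs one comparison per further entry. Most of the
  comparisons below hold for each fixed \<open>x\<close> and \<open>y\<close>, so that they can be made by rewriting under
  the quantifiers.
\<close>

lemma all_equivalent_Cons: "all_equivalent (P # Ps) \<longleftrightarrow> (\<forall>R\<in>set Ps. R \<longleftrightarrow> P)"
  unfolding all_equivalent_def by auto

lemma f2_eq_g2_equivalents:
  "all_equivalent
    [(\<forall>x\<in>carrier Q. \<forall>y\<in>carrier Q. x \<oslash> (x \<otimes> y) = x \<oslash> (y \<otimes> x)),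
     (\<forall>x\<in>carrier Q. \<forall>y\<in>carrier Q. x \<otimes> y = y \<otimes> x),
     groupoid_equiv (carrier Q) (opposite (ldiv Q)) (rdiv Q),
     groupoid_equiv (carrier Q) (ldiv Q) (opposite (rdiv Q)),
     (\<forall>x\<in>carrier Q. \<forall>y\<in>carrier Q. x \<oslash> (x \<otimes> y) = (y \<setminus> x) \<oslash> x),
     (\<forall>x\<in>carrier Q. \<forall>y\<in>carrier Q. x \<oslash> (y \<otimes> x) = (x \<oslash> y) \<oslash> x)]"
proof -
  have comm: "(\<forall>x\<in>carrier Q. \<forall>y\<in>carrier Q. x \<oslash> (x \<otimes> y) = x \<oslash> (y \<otimes> x)) \<longleftrightarrow>
      (\<forall>x\<in>carrier Q. \<forall>y\<in>carrier Q. x \<otimes> y = y \<otimes> x)"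
    by (simp add: rdiv_left_cancel_iff m_closed cong: ball_cong)
  moreover have "groupoid_equiv (carrier Q) (opposite (ldiv Q)) (rdiv Q) \<longleftrightarrow>
      (\<forall>x\<in>carrier Q. \<forall>y\<in>carrier Q. x \<otimes> y = y \<otimes> x)"
    unfolding groupoid_equiv_def opposite_def commutative_iff_ldiv_eq_rdiv ..
  moreover have "groupoid_equiv (carrier Q) (ldiv Q) (opposite (rdiv Q)) \<longleftrightarrow>
      (\<forall>x\<in>carrier Q. \<forall>y\<in>carrier Q. x \<otimes> y = y \<otimes> x)"
    unfolding groupoid_equiv_def opposite_def commutative_iff_ldiv_eq_rdiv by blast
  moreover have "(\<forall>x\<in>carrier Q. \<forall>y\<in>carrier Q. x \<oslash> (x \<otimes> y) = (y \<setminus> x) \<oslash> x) \<longleftrightarrow>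
      (\<forall>x\<in>carrier Q. \<forall>y\<in>carrier Q. x \<otimes> y = y \<otimes> x)"
    using comm by (simp add: ldiv_rdiv_right_eq cong: ball_cong)
  moreover have "(\<forall>x\<in>carrier Q. \<forall>y\<in>carrier Q. x \<oslash> (y \<otimes> x) = (x \<oslash> y) \<oslash> x) \<longleftrightarrow>
      (\<forall>x\<in>carrier Q. \<forall>y\<in>carrier Q. x \<otimes> y = y \<otimes> x)"
    using comm by (auto simp: rdiv_rdiv_eq cong: ball_cong)
  ultimately show ?thesis
    by (simp only: all_equivalent_Cons list.set ball_simps simp_thms)
qed

lemma f1_eq_f2_equivalents:
  "all_equivalent
    [(\<forall>x\<in>carrier Q. \<forall>y\<in>carrier Q. (y \<otimes> x) \<setminus> x = x \<oslash> (x \<otimes> y)),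
     (\<forall>x\<in>carrier Q. \<forall>y\<in>carrier Q. ((y \<otimes> x) \<setminus> x) \<otimes> (x \<otimes> y) = x),
     (\<forall>x\<in>carrier Q. \<forall>y\<in>carrier Q. (y \<otimes> x) \<otimes> (x \<oslash> (x \<otimes> y)) = x),
     (\<forall>x\<in>carrier Q. \<forall>y\<in>carrier Q. x \<setminus> (y \<setminus> x) = (x \<oslash> y) \<oslash> x)]"
  unfolding all_equivalent_Cons
  by (simp add: ldiv_eq_rdiv_iff m_closed ldiv_ldiv_eq rdiv_rdiv_eq cong: ball_cong)

lemma g1_eq_g2_equivalents:
  "all_equivalent
    [(\<forall>x\<in>carrier Q. \<forall>y\<in>carrier Q. (x \<otimes> y) \<setminus> x = x \<oslash> (y \<otimes> x)),
     (\<forall>x\<in>carrier Q. \<forall>y\<in>carrier Q. ((x \<otimes> y) \<setminus> x) \<otimes> (y \<otimes> x) = x),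
     (\<forall>x\<in>carrier Q. \<forall>y\<in>carrier Q. (x \<otimes> y) \<otimes> (x \<oslash> (y \<otimes> x)) = x),
     (\<forall>x\<in>carrier Q. \<forall>y\<in>carrier Q. x \<setminus> (x \<oslash> y) = (y \<setminus> x) \<oslash> x)]"
  unfolding all_equivalent_Cons
  by (simp add: ldiv_eq_rdiv_iff m_closed ldiv_rdiv_eq ldiv_rdiv_right_eq cong: ball_cong)

lemma f1_eq_g2_equivalents:
  "all_equivalent
    [(\<forall>x\<in>carrier Q. \<forall>y\<in>carrier Q. (y \<otimes> x) \<setminus> x = x \<oslash> (y \<otimes> x)),
     (\<forall>x\<in>carrier Q. \<forall>y\<in>carrier Q. (y \<otimes> x) \<otimes> (x \<oslash> (y \<otimes> x)) = x),
     (\<forall>x\<in>carrier Q. \<forall>y\<in>carrier Q. ((y \<otimes> x) \<setminus> x) \<otimes> (y \<otimes> x) = x),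
     (\<forall>x\<in>carrier Q. \<forall>y\<in>carrier Q. x \<otimes> ((y \<setminus> x) \<oslash> x) = y \<setminus> x),
     (\<forall>x\<in>carrier Q. \<forall>y\<in>carrier Q. (x \<setminus> (y \<setminus> x)) \<otimes> x = y \<setminus> x)]"
proof -
  have "x \<otimes> ((y \<setminus> x) \<oslash> x) = y \<setminus> x \<longleftrightarrow> (y \<otimes> x) \<setminus> x = x \<oslash> (y \<otimes> x)"
    and "(x \<setminus> (y \<setminus> x)) \<otimes> x = y \<setminus> x \<longleftrightarrow> (y \<otimes> x) \<setminus> x = x \<oslash> (y \<otimes> x)"
    if "x \<in> carrier Q" "y \<in> carrier Q" for x y
    using that ldiv_eq_rdiv_iff[of x x "y \<setminus> x" "y \<setminus> x"]
    by (simp_all only: ldiv_closed(1) ldiv_ldiv_eq ldiv_rdiv_right_eq)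
  then show ?thesis
    unfolding all_equivalent_Cons by (simp add: ldiv_eq_rdiv_iff m_closed cong: ball_cong)
qed

lemma f2_eq_g1_equivalents:
  "all_equivalent
    [(\<forall>x\<in>carrier Q. \<forall>y\<in>carrier Q. x \<oslash> (x \<otimes> y) = (x \<otimes> y) \<setminus> x),
     (\<forall>x\<in>carrier Q. \<forall>y\<in>carrier Q. ((x \<otimes> y) \<setminus> x) \<otimes> (x \<otimes> y) = x),
     (\<forall>x\<in>carrier Q. \<forall>y\<in>carrier Q. ((y \<otimes> x) \<setminus> x) \<otimes> (y \<otimes> x) = x),
     (\<forall>x\<in>carrier Q. \<forall>y\<in>carrier Q. x \<otimes> ((x \<oslash> y) \<oslash> x) = x \<oslash> y),
     (\<forall>x\<in>carrier Q. \<forall>y\<in>carrier Q. (x \<setminus> (x \<oslash> y)) \<otimes> x = x \<oslash> y)]"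
proof -
  have "x \<otimes> ((x \<oslash> y) \<oslash> x) = x \<oslash> y \<longleftrightarrow> x \<oslash> (x \<otimes> y) = (x \<otimes> y) \<setminus> x"
    and "(x \<setminus> (x \<oslash> y)) \<otimes> x = x \<oslash> y \<longleftrightarrow> x \<oslash> (x \<otimes> y) = (x \<otimes> y) \<setminus> x"
    and "((x \<otimes> y) \<setminus> x) \<otimes> (x \<otimes> y) = x \<longleftrightarrow> x \<oslash> (x \<otimes> y) = (x \<otimes> y) \<setminus> x"
    if "x \<in> carrier Q" "y \<in> carrier Q" for x y
    using that ldiv_eq_rdiv_iff[of x x "x \<oslash> y" "x \<oslash> y"] ldiv_eq_rdiv_iff(1)[of "x \<otimes> y" "x \<otimes> y" x x]
    by (auto simp only: rdiv_closed(1) ldiv_rdiv_eq rdiv_rdiv_eq m_closed)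
  \<comment> \<open>For fixed \<open>x\<close>, both \<open>x \<otimes> y\<close> and \<open>y \<otimes> x\<close> run through the whole loop.\<close>
  moreover have "(\<forall>y\<in>carrier Q. ((y \<otimes> x) \<setminus> x) \<otimes> (y \<otimes> x) = x) \<longleftrightarrow>
      (\<forall>y\<in>carrier Q. ((x \<otimes> y) \<setminus> x) \<otimes> (x \<otimes> y) = x)"
    if "x \<in> carrier Q" for x
    using that by (metis m_closed ldiv_closed rdiv_closed)
  ultimately show ?thesis
    unfolding all_equivalent_Cons by (simp cong: ball_cong)
qed

end

section \<open>The four maps\<close>

theorem lemma2p4:
  fixes Q :: "('a, 'b) monoid_scheme" (structure)
    and f1 g1 f2 g2 :: "'a \<Rightarrow> 'a \<Rightarrow> 'a"
  assumes "middle_bol_loop Q"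
    and "f1 \<in> carrier Q \<rightarrow> carrier Q \<rightarrow> carrier Q"
    and "g1 \<in> carrier Q \<rightarrow> carrier Q \<rightarrow> carrier Q"
    and "f2 \<in> carrier Q \<rightarrow> carrier Q \<rightarrow> carrier Q"
    and "g2 \<in> carrier Q \<rightarrow> carrier Q \<rightarrow> carrier Q"
    and "\<forall>x\<in>carrier Q. \<forall>y\<in>carrier Q. f1 x y = (y \<otimes> x) \<setminus> x"
    and "\<forall>x\<in>carrier Q. \<forall>y\<in>carrier Q. g1 x y = (x \<otimes> y) \<setminus> x"
  shows
    "((\<forall>x\<in>carrier Q. \<forall>y\<in>carrier Q. f2 x y = x \<oslash> (x \<otimes> y))
      \<longleftrightarrow> (\<forall>x\<in>carrier Q. \<forall>y\<in>carrier Q. f2 x y = (x \<oslash> y) \<oslash> x)) \<and>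
     ((\<forall>x\<in>carrier Q. \<forall>y\<in>carrier Q. f2 x y = x \<oslash> (x \<otimes> y))
      \<longrightarrow> (\<forall>x\<in>carrier Q.
          f2 x x = inv x \<and> f2 \<one> x = inv x \<and> f2 (inv x) x = inv x \<and>
          f2 x (inv x) = x \<and> f2 \<one> (inv x) = x \<and>
          f2 x \<one> = \<one> \<and> f2 (inv x) \<one> = \<one> \<and> f2 \<one> \<one> = \<one>)) \<and>
     ((\<forall>x\<in>carrier Q. \<forall>y\<in>carrier Q. g2 x y = x \<oslash> (y \<otimes> x))
      \<longleftrightarrow> (\<forall>x\<in>carrier Q. \<forall>y\<in>carrier Q. g2 x y = (y \<setminus> x) \<oslash> x)) \<and>
     ((\<forall>x\<in>carrier Q. \<forall>y\<in>carrier Q. g2 x y = x \<oslash> (y \<otimes> x))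
      \<longrightarrow> (\<forall>x\<in>carrier Q.
          g2 x x = inv x \<and> g2 \<one> x = inv x \<and> g2 (inv x) x = inv x \<and>
          g2 x (inv x) = x \<and> g2 \<one> (inv x) = x \<and>
          g2 x \<one> = \<one> \<and> g2 (inv x) \<one> = \<one> \<and> g2 \<one> \<one> = \<one>)) \<and>
     ((\<forall>x\<in>carrier Q. \<forall>y\<in>carrier Q. f2 x y = x \<oslash> (x \<otimes> y)) \<longrightarrow>
      (\<forall>x\<in>carrier Q. \<forall>y\<in>carrier Q. g2 x y = x \<oslash> (y \<otimes> x)) \<longrightarrow>
     all_equivalent
       [(\<forall>x\<in>carrier Q. \<forall>y\<in>carrier Q. f2 x y = g2 x y),
        (\<forall>x\<in>carrier Q. \<forall>y\<in>carrier Q. x \<otimes> y = y \<otimes> x),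
        groupoid_equiv (carrier Q) (opposite (ldiv Q)) (rdiv Q),
        groupoid_equiv (carrier Q) (ldiv Q) (opposite (rdiv Q)),
        (\<forall>x\<in>carrier Q. \<forall>y\<in>carrier Q. x \<oslash> (x \<otimes> y) = (y \<setminus> x) \<oslash> x),
        (\<forall>x\<in>carrier Q. \<forall>y\<in>carrier Q. x \<oslash> (y \<otimes> x) = (x \<oslash> y) \<oslash> x)] \<and>
     all_equivalent
       [(\<forall>x\<in>carrier Q. \<forall>y\<in>carrier Q. f1 x y = f2 x y),
        (\<forall>x\<in>carrier Q. \<forall>y\<in>carrier Q. ((y \<otimes> x) \<setminus> x) \<otimes> (x \<otimes> y) = x),
        (\<forall>x\<in>carrier Q. \<forall>y\<in>carrier Q. (y \<otimes> x) \<otimes> (x \<oslash> (x \<otimes> y)) = x),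
        (\<forall>x\<in>carrier Q. \<forall>y\<in>carrier Q. x \<setminus> (y \<setminus> x) = (x \<oslash> y) \<oslash> x)] \<and>
     all_equivalent
       [(\<forall>x\<in>carrier Q. \<forall>y\<in>carrier Q. g1 x y = g2 x y),
        (\<forall>x\<in>carrier Q. \<forall>y\<in>carrier Q. ((x \<otimes> y) \<setminus> x) \<otimes> (y \<otimes> x) = x),
        (\<forall>x\<in>carrier Q. \<forall>y\<in>carrier Q. (x \<otimes> y) \<otimes> (x \<oslash> (y \<otimes> x)) = x),
        (\<forall>x\<in>carrier Q. \<forall>y\<in>carrier Q. x \<setminus> (x \<oslash> y) = (y \<setminus> x) \<oslash> x)] \<and>
     all_equivalent
       [(\<forall>x\<in>carrier Q. \<forall>y\<in>carrier Q. f1 x y = g2 x y),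
        (\<forall>x\<in>carrier Q. \<forall>y\<in>carrier Q. (y \<otimes> x) \<otimes> (x \<oslash> (y \<otimes> x)) = x),
        (\<forall>x\<in>carrier Q. \<forall>y\<in>carrier Q. ((y \<otimes> x) \<setminus> x) \<otimes> (y \<otimes> x) = x),
        (\<forall>x\<in>carrier Q. \<forall>y\<in>carrier Q. x \<otimes> ((y \<setminus> x) \<oslash> x) = y \<setminus> x),
        (\<forall>x\<in>carrier Q. \<forall>y\<in>carrier Q. (x \<setminus> (y \<setminus> x)) \<otimes> x = y \<setminus> x)] \<and>
     all_equivalent
       [(\<forall>x\<in>carrier Q. \<forall>y\<in>carrier Q. f2 x y = g1 x y),
        (\<forall>x\<in>carrier Q. \<forall>y\<in>carrier Q. ((x \<otimes> y) \<setminus> x) \<otimes> (x \<otimes> y) = x),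
        (\<forall>x\<in>carrier Q. \<forall>y\<in>carrier Q. ((y \<otimes> x) \<setminus> x) \<otimes> (y \<otimes> x) = x),
        (\<forall>x\<in>carrier Q. \<forall>y\<in>carrier Q. x \<otimes> ((x \<oslash> y) \<oslash> x) = x \<oslash> y),
        (\<forall>x\<in>carrier Q. \<forall>y\<in>carrier Q. (x \<setminus> (x \<oslash> y)) \<otimes> x = x \<oslash> y)] \<and>
     (\<forall>x\<in>carrier Q. \<forall>y\<in>carrier Q. \<forall>z\<in>carrier Q.
          f2 x y \<otimes> f1 x z = x \<otimes> (((z \<otimes> x) \<otimes> (x \<otimes> y)) \<setminus> x) \<and>
          x \<otimes> (((z \<otimes> x) \<otimes> (x \<otimes> y)) \<setminus> x) = (x \<oslash> ((z \<otimes> x) \<otimes> (x \<otimes> y))) \<otimes> x) \<and>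
     (\<forall>x\<in>carrier Q. \<forall>y\<in>carrier Q. \<forall>z\<in>carrier Q.
          ((x \<oslash> y) \<oslash> x) \<otimes> (x \<setminus> (z \<setminus> x)) = x \<otimes> (((z \<otimes> x) \<otimes> (x \<otimes> y)) \<setminus> x) \<and>
          x \<otimes> (((z \<otimes> x) \<otimes> (x \<otimes> y)) \<setminus> x) = (x \<oslash> ((z \<otimes> x) \<otimes> (x \<otimes> y))) \<otimes> x) \<and>
     (\<forall>x\<in>carrier Q. \<forall>y\<in>carrier Q. \<forall>z\<in>carrier Q.
          g2 x y \<otimes> g1 x z = x \<otimes> (((x \<otimes> z) \<otimes> (y \<otimes> x)) \<setminus> x) \<and>
          x \<otimes> (((x \<otimes> z) \<otimes> (y \<otimes> x)) \<setminus> x) = (x \<oslash> ((x \<otimes> z) \<otimes> (y \<otimes> x))) \<otimes> x) \<and>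
     (\<forall>x\<in>carrier Q. \<forall>y\<in>carrier Q. \<forall>z\<in>carrier Q.
          ((y \<setminus> x) \<oslash> x) \<otimes> (x \<setminus> (x \<oslash> z)) = x \<otimes> (((x \<otimes> z) \<otimes> (y \<otimes> x)) \<setminus> x) \<and>
          x \<otimes> (((x \<otimes> z) \<otimes> (y \<otimes> x)) \<setminus> x) = (x \<oslash> ((x \<otimes> z) \<otimes> (y \<otimes> x))) \<otimes> x) \<and>
     (\<forall>x\<in>carrier Q. \<forall>y\<in>carrier Q. \<forall>z\<in>carrier Q.
          f2 x y \<otimes> g1 x z = x \<otimes> (((x \<otimes> z) \<otimes> (x \<otimes> y)) \<setminus> x) \<and>
          x \<otimes> (((x \<otimes> z) \<otimes> (x \<otimes> y)) \<setminus> x) = (x \<oslash> ((x \<otimes> z) \<otimes> (x \<otimes> y))) \<otimes> x) \<and>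
     (\<forall>x\<in>carrier Q. \<forall>y\<in>carrier Q. \<forall>z\<in>carrier Q.
          ((x \<oslash> y) \<oslash> x) \<otimes> (x \<setminus> (x \<oslash> z)) = x \<otimes> (((x \<otimes> z) \<otimes> (x \<otimes> y)) \<setminus> x) \<and>
          x \<otimes> (((x \<otimes> z) \<otimes> (x \<otimes> y)) \<setminus> x) = (x \<oslash> ((x \<otimes> z) \<otimes> (x \<otimes> y))) \<otimes> x) \<and>
     (\<forall>x\<in>carrier Q. \<forall>y\<in>carrier Q. \<forall>z\<in>carrier Q.
          g2 x y \<otimes> f1 x z = x \<otimes> (((z \<otimes> x) \<otimes> (y \<otimes> x)) \<setminus> x) \<and>
          x \<otimes> (((z \<otimes> x) \<otimes> (y \<otimes> x)) \<setminus> x) = (x \<oslash> ((z \<otimes> x) \<otimes> (y \<otimes> x))) \<otimes> x) \<and>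
     (\<forall>x\<in>carrier Q. \<forall>y\<in>carrier Q. \<forall>z\<in>carrier Q.
          ((y \<setminus> x) \<oslash> x) \<otimes> (x \<setminus> (z \<setminus> x)) = x \<otimes> (((z \<otimes> x) \<otimes> (y \<otimes> x)) \<setminus> x) \<and>
          x \<otimes> (((z \<otimes> x) \<otimes> (y \<otimes> x)) \<setminus> x) = (x \<oslash> ((z \<otimes> x) \<otimes> (y \<otimes> x))) \<otimes> x))"
proof -
  interpret middle_bol_loop Q by fact
  have f1: "f1 x y = (y \<otimes> x) \<setminus> x" and g1: "g1 x y = (x \<otimes> y) \<setminus> x"
    if "x \<in> carrier Q" "y \<in> carrier Q" for x y
    using assms(6,7) that by blast+
  show ?thesis
    apply (intro conjI impI)
    subgoal by (simp add: rdiv_rdiv_eq cong: ball_cong)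
    subgoal by (simp add: rdiv_mult_left_values rdiv_mult_left_values(6)[OF one_closed]
          inv_closed one_closed inv_inv)
    subgoal by (simp add: ldiv_rdiv_right_eq cong: ball_cong)
    subgoal by (simp add: rdiv_mult_right_values rdiv_mult_right_values(6)[OF one_closed]
          inv_closed one_closed inv_inv)
    subgoal using f2_eq_g2_equivalents by (simp cong: ball_cong)
    subgoal using f1_eq_f2_equivalents by (simp add: f1 cong: ball_cong)
    subgoal using g1_eq_g2_equivalents by (simp add: g1 cong: ball_cong)
    subgoal using f1_eq_g2_equivalents by (simp add: f1 cong: ball_cong)
    subgoal using f2_eq_g1_equivalents by (simp add: g1 cong: ball_cong)
    \<comment> \<open>By the alternative forms, each remaining product is one of a right and a left quotient
      of \<open>x\<close>.\<close>
    by (simp_all add: f1 g1 ldiv_ldiv_eq ldiv_rdiv_eq rdiv_rdiv_eq ldiv_rdiv_right_eq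
        rdiv_mult_ldiv m_closed)
qed

end
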